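(* Let $q\in(1,\infty)$. For $k\in\mathbb{N}$ and $R\ge k^{1+1/q}$, $$|B_{k,q}(R)|=V_{k,q}(R)\,\bigl(1+O(k^{1+1/q}/R)\bigr).$$
   Context: $B_{k,q}(R):=\{a\in\mathbb{Z}^k:\sum_{i=1}^k|a_i|^q\le R^q\}$ is the discrete $L_q$ lattice ball and $|B_{k,q}(R)|$ its number of elements. $V_{k,q}(R)$ is the Lebesgue volume of the ball $\{x\in\mathbb{R}^k:\|x\|_q\le R\}$, i.e. $V_{k,q}(R)=R^k\,2^k\,\Gamma(1/q+1)^k/\Gamma(k/q+1)$. The implied constant in $O(\cdot)$ is uniform in $k$ and $R$. *)

theory Defs
  imports "HOL-Analysis.Analysis"
begin

text \<open>
  Vectors of dimension \<open>k\<close> are extensional functions on the index set \<open>{1..k}\<close>; the dimension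
  is thus an ordinary natural number that can be quantified inside a formula.
\<close>

definition lq_lattice_ball :: "nat \<Rightarrow> real \<Rightarrow> real \<Rightarrow> (nat \<Rightarrow> int) set" where
  "lq_lattice_ball k q R =
     {a \<in> {1..k} \<rightarrow>\<^sub>E UNIV. (\<Sum>i=1..k. \<bar>real_of_int (a i)\<bar> powr q) \<le> R powr q}"

definition lq_norm :: "nat \<Rightarrow> real \<Rightarrow> (nat \<Rightarrow> real) \<Rightarrow> real" where
  "lq_norm k q x = (\<Sum>i=1..k. \<bar>x i\<bar> powr q) powr (1 / q)"

text \<open>
  The ball is a Borel set, so the product of the Borel-Lebesgue measures gives its Lebesgue volume.
\<close>

definition lq_ball_volume :: "nat \<Rightarrow> real \<Rightarrow> real \<Rightarrow> real" where
  "lq_ball_volume k q R =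
     measure (\<Pi>\<^sub>M i\<in>{1..k}. lborel) {x \<in> {1..k} \<rightarrow>\<^sub>E UNIV. lq_norm k q x \<le> R}"

end

theory Submission
  imports Defs
begin

text \<open>
  The count \<open>|B(R)|\<close> is itself a volume: the half-open unit cubes centred at the points of
  \<open>B(R)\<close> are disjoint and have total volume \<open>|B(R)|\<close>. Every point of such a cube is within
  \<open>L\<^sub>q\<close> distance \<open>r = k powr (1/q) / 2\<close> of the centre, so Minkowski's inequality
  (\<open>sum_abs_powr_triangle\<close>) places the union of the cubes between the continuous balls of radius
  \<open>R - r\<close> and \<open>R + r\<close> (\<open>volume_le_card\<close> and \<open>card_le_volume\<close>).
  The volume is homogeneous of degree \<open>k\<close> (\<open>lq_ball_volume_scale\<close>), so both bounds are multiples
  of \<open>V(R)\<close>, with factors \<open>(1 - r/R)^k\<close> and \<open>(1 + r/R)^k\<close>. The hypothesis on \<open>R\<close> says that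
  \<open>k * (r/R) \<le> 1/2\<close>, and in this range both factors differ from \<open>1\<close> by at most \<open>2 * k * (r/R)\<close>,
  which is \<open>k powr (1 + 1/q) / R\<close>; the implied constant is thus \<open>1\<close>.
\<close>

section \<open>The triangle inequality for the q-norm\<close>

text \<open>
  Coordinates may vanish, so convexity is needed on \<open>[0, \<infinity>)\<close>, while second derivatives give it
  only on \<open>(0, \<infinity>)\<close>; the boundary case amounts to \<open>s powr q \<le> s\<close> for \<open>s\<close> in \<open>[0, 1]\<close>.
\<close>

lemma powr_convex_ineq:
  fixes u v :: real
  assumes q: "1 \<le> q" and t: "0 \<le> t" "t \<le> 1" and uv: "0 \<le> u" "0 \<le> v"
  shows "((1 - t) * u + t * v) powr q \<le> (1 - t) * u powr q + t * v powr q"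
proof -
  have scale: "(s * w) powr q \<le> s * w powr q" if "0 \<le> s" "s \<le> 1" "0 \<le> w" for s w :: real
  proof -
    have "s powr q \<le> s"
      using powr_mono'[of 1 q s] q that by simp
    then have "s powr q * w powr q \<le> s * w powr q"
      by (intro mult_right_mono) auto
    then show ?thesis
      using that by (simp add: powr_mult)
  qed
  consider "u = 0" | "v = 0" | "0 < u" "0 < v"
    using uv by linarith
  then show ?thesis
  proof cases
    case 1
    then show ?thesis using scale[of t v] t uv by simp
  next
    case 2
    then show ?thesis using scale[of "1 - t" u] t uv by simp
  next
    case 3
    then show ?thesis using convex_onD[OF powr_convex[OF q], of t u v] t by simp
  qed
qed

text \<open>
  Write \<open>|x i + y i| / (A + B)\<close> as at most a convex combination of \<open>|x i| / A\<close> and \<open>|y i| / B\<close>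
  with weights \<open>A / (A + B)\<close> and \<open>B / (A + B)\<close>; convexity of \<open>t powr q\<close> then gives the inequality
  termwise.
\<close>

lemma sum_abs_powr_triangle:
  fixes x y :: "'a \<Rightarrow> real"
  assumes q: "1 \<le> q" and A: "0 < A" and B: "0 < B"
    and x: "(\<Sum>i\<in>I. \<bar>x i\<bar> powr q) \<le> A powr q"
    and y: "(\<Sum>i\<in>I. \<bar>y i\<bar> powr q) \<le> B powr q"
  shows "(\<Sum>i\<in>I. \<bar>x i + y i\<bar> powr q) \<le> (A + B) powr q"
proof -
  define t where "t = B / (A + B)"
  have t: "0 \<le> t" "t \<le> 1" "1 - t = A / (A + B)"
    using A B by (auto simp: t_def field_simps)
  have term_le: "\<bar>x i + y i\<bar> powr q
      \<le> (A + B) powr q * ((1 - t) * (\<bar>x i\<bar> powr q / A powr q) + t * (\<bar>y i\<bar> powr q / B powr q))"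
    for i
  proof -
    have "(\<bar>x i\<bar> + \<bar>y i\<bar>) / (A + B) = (1 - t) * (\<bar>x i\<bar> / A) + t * (\<bar>y i\<bar> / B)"
      unfolding t(3) using A B by (simp add: t_def add_divide_distrib)
    also have "\<dots> powr q \<le> (1 - t) * (\<bar>x i\<bar> / A) powr q + t * (\<bar>y i\<bar> / B) powr q"
      using powr_convex_ineq[of q t "\<bar>x i\<bar> / A" "\<bar>y i\<bar> / B"] q t A B by simp
    finally have "((\<bar>x i\<bar> + \<bar>y i\<bar>) / (A + B)) powr q
        \<le> (1 - t) * (\<bar>x i\<bar> powr q / A powr q) + t * (\<bar>y i\<bar> powr q / B powr q)"
      using A B by (simp add: powr_divide)
    then have "(\<bar>x i\<bar> + \<bar>y i\<bar>) powr q
      \<le> (A + B) powr q * ((1 - t) * (\<bar>x i\<bar> powr q / A powr q) + t * (\<bar>y i\<bar> powr q / B powr q))"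
      using A B by (simp add: powr_divide divide_le_eq mult.commute)
    moreover have "\<bar>x i + y i\<bar> powr q \<le> (\<bar>x i\<bar> + \<bar>y i\<bar>) powr q"
      using q by (intro powr_mono2) auto
    ultimately show ?thesis by linarith
  qed
  have "(\<Sum>i\<in>I. \<bar>x i + y i\<bar> powr q)
      \<le> (\<Sum>i\<in>I. (A + B) powr q * ((1 - t) * (\<bar>x i\<bar> powr q / A powr q) + t * (\<bar>y i\<bar> powr q / B powr q)))"
    by (intro sum_mono term_le)
  also have "\<dots> = (A + B) powr q * ((1 - t) * ((\<Sum>i\<in>I. \<bar>x i\<bar> powr q) / A powr q)
      + t * ((\<Sum>i\<in>I. \<bar>y i\<bar> powr q) / B powr q))"
    by (simp only: sum_distrib_left[symmetric] sum.distrib sum_divide_distrib)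
  also have "\<dots> \<le> (A + B) powr q * ((1 - t) * 1 + t * 1)"
    using x y A B t(1,2) by (intro mult_left_mono add_mono) auto
  finally show ?thesis by simp
qed

section \<open>Homogeneity of Lebesgue measure on a finite product\<close>

interpretation lborel_product: product_sigma_finite "\<lambda>_::'a. lborel :: real measure"
  by standard

lemma emeasure_lborel_scale:
  fixes c :: real
  assumes "0 < c" and "A \<in> sets borel"
  shows "emeasure lborel A = ennreal c * emeasure lborel ((*) c -` A)"
proof -
  have "emeasure lborel A = emeasure (density (distr lborel borel ((*) c)) (\<lambda>_. ennreal \<bar>c\<bar>)) A"
    using lborel_distr_mult'[of c] assms by simp
  also have "\<dots> = ennreal c * emeasure (distr lborel borel ((*) c)) A"
    using assms by (subst emeasure_density_const) auto
  also have "\<dots> = ennreal c * emeasure lborel ((*) c -` A)"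
    using assms by (subst emeasure_distr) auto
  finally show ?thesis .
qed

lemma PiM_lborel_scale:
  fixes c :: real
  assumes "finite I" and "0 < c"
  shows "scale_measure (ennreal (c ^ card I))
      (distr (PiM I (\<lambda>_. lborel)) (PiM I (\<lambda>_. lborel)) (\<lambda>x. \<lambda>i\<in>I. c * x i)) = PiM I (\<lambda>_. lborel)"
    (is "scale_measure _ (distr ?P ?P ?s) = _")
proof (rule lborel_product.PiM_eqI[OF \<open>finite I\<close>])
  fix A :: "'a \<Rightarrow> real set"
  assume "\<And>i. i \<in> I \<Longrightarrow> A i \<in> sets lborel"
  then have A: "\<And>i. i \<in> I \<Longrightarrow> A i \<in> sets borel"
    by simp
  have s: "?s \<in> measurable ?P ?P"
    by measurable
  have pre: "(*) c -` A i \<in> sets borel" if "i \<in> I" for i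
    using measurable_sets[of "(*) c" borel borel "A i"] A[OF that] by simp
  have "?s -` PiE I A \<inter> space ?P = PiE I (\<lambda>i. (*) c -` A i)"
    by (auto simp: space_PiM PiE_iff)
  moreover have "PiE I A \<in> sets ?P"
    using A \<open>finite I\<close> by (intro sets_PiM_I_finite) auto
  ultimately have "emeasure (scale_measure (ennreal (c ^ card I)) (distr ?P ?P ?s)) (PiE I A)
      = ennreal (c ^ card I) * emeasure ?P (PiE I (\<lambda>i. (*) c -` A i))"
    using s by (simp add: emeasure_distr)
  also have "\<dots> = (\<Prod>i\<in>I. ennreal c) * (\<Prod>i\<in>I. emeasure lborel ((*) c -` A i))"
    using assms pre by (simp add: lborel_product.emeasure_PiM ennreal_power)
  also have "\<dots> = (\<Prod>i\<in>I. emeasure lborel (A i))"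
    using assms A by (simp only: prod.distrib[symmetric] emeasure_lborel_scale cong: prod.cong)
  finally show "emeasure (scale_measure (ennreal (c ^ card I)) (distr ?P ?P ?s)) (PiE I A)
      = (\<Prod>i\<in>I. emeasure lborel (A i))" .
qed simp

section \<open>The continuous ball\<close>

abbreviation lborel_pow :: "nat \<Rightarrow> (nat \<Rightarrow> real) measure" where
  "lborel_pow k \<equiv> PiM {1..k} (\<lambda>_. lborel)"

definition lq_ball :: "nat \<Rightarrow> real \<Rightarrow> real \<Rightarrow> (nat \<Rightarrow> real) set" where
  "lq_ball k q R = {x \<in> {1..k} \<rightarrow>\<^sub>E UNIV. (\<Sum>i=1..k. \<bar>x i\<bar> powr q) \<le> R powr q}"

lemma lq_ball_volume_eq:
  assumes "0 < q" and "0 \<le> R"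
  shows "lq_ball_volume k q R = measure (lborel_pow k) (lq_ball k q R)"
proof -
  have "lq_norm k q x \<le> R \<longleftrightarrow> (\<Sum>i=1..k. \<bar>x i\<bar> powr q) \<le> R powr q" for x
  proof -
    define S where "S = (\<Sum>i=1..k. \<bar>x i\<bar> powr q)"
    have S: "0 \<le> S"
      unfolding S_def by (intro sum_nonneg) auto
    have "S powr (1 / q) \<le> R \<longleftrightarrow> S \<le> R powr q"
    proof
      assume "S powr (1 / q) \<le> R"
      then have "(S powr (1 / q)) powr q \<le> R powr q"
        using assms by (intro powr_mono2) auto
      then show "S \<le> R powr q"
        using assms S by (simp add: powr_powr)
    next
      assume "S \<le> R powr q"
      then have "S powr (1 / q) \<le> (R powr q) powr (1 / q)"
        using assms S by (intro powr_mono2) auto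
      then show "S powr (1 / q) \<le> R"
        using assms by (simp add: powr_powr)
    qed
    then show ?thesis
      by (simp add: lq_norm_def S_def)
  qed
  then show ?thesis
    by (simp add: lq_ball_volume_def lq_ball_def)
qed

lemma lq_ball_measurable: "lq_ball k q R \<in> sets (lborel_pow k)"
proof -
  have "{x \<in> space (lborel_pow k). (\<Sum>i=1..k. \<bar>x i\<bar> powr q) \<le> R powr q} \<in> sets (lborel_pow k)"
    by measurable
  then show ?thesis
    by (simp add: lq_ball_def space_PiM)
qed

text \<open>The bound serves to show that both kinds of balls are bounded, hence of finite size.\<close>

lemma abs_le_if_sum_powr_le:
  fixes x :: "'a \<Rightarrow> real"
  assumes "finite I" "i \<in> I" and "0 < q" "0 \<le> R" and "(\<Sum>i\<in>I. \<bar>x i\<bar> powr q) \<le> R powr q"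
  shows "\<bar>x i\<bar> \<le> R"
proof (rule ccontr)
  assume "\<not> \<bar>x i\<bar> \<le> R"
  then have "R powr q < \<bar>x i\<bar> powr q"
    using assms by (intro powr_less_mono2) auto
  also have "\<dots> \<le> (\<Sum>i\<in>I. \<bar>x i\<bar> powr q)"
    using assms(1,2) by (intro member_le_sum) auto
  finally show False
    using assms by simp
qed

lemma lq_ball_fmeasurable:
  assumes "0 < q" and "0 \<le> R"
  shows "lq_ball k q R \<in> fmeasurable (lborel_pow k)"
proof -
  have "lq_ball k q R \<subseteq> ({1..k} \<rightarrow>\<^sub>E {-R..R})"
  proof
    fix x assume x: "x \<in> lq_ball k q R"
    then have abs_le: "\<bar>x i\<bar> \<le> R" if "i \<in> {1..k}" for i
      using abs_le_if_sum_powr_le[of "{1..k}" i q R x] that assms by (simp add: lq_ball_def)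
    have "x i \<in> {-R..R}" if "i \<in> {1..k}" for i
      using abs_le[OF that] unfolding abs_le_iff atLeastAtMost_iff by linarith
    with x show "x \<in> ({1..k} \<rightarrow>\<^sub>E {-R..R})"
      unfolding lq_ball_def by (blast intro: PiE_arb)
  qed
  moreover have "({1..k} \<rightarrow>\<^sub>E {-R..R}) \<in> fmeasurable (lborel_pow k)"
  proof (rule fmeasurableI)
    show "({1..k} \<rightarrow>\<^sub>E {-R..R}) \<in> sets (lborel_pow k)"
      by (intro sets_PiM_I_finite) auto
    have "emeasure (lborel_pow k) ({1..k} \<rightarrow>\<^sub>E {-R..R}) = (\<Prod>i\<in>{1..k}. ennreal (2 * R))"
      using assms(2) by (subst lborel_product.emeasure_PiM) auto
    also have "\<dots> = ennreal ((2 * R) ^ k)"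
      using assms(2) unfolding prod_constant by (subst ennreal_power) auto
    also have "\<dots> < \<infinity>"
      by simp
    finally show "emeasure (lborel_pow k) ({1..k} \<rightarrow>\<^sub>E {-R..R}) < \<infinity>" .
  qed
  ultimately show ?thesis
    by (rule fmeasurableI2[OF _ _ lq_ball_measurable, rotated])
qed

lemma lq_ball_volume_scale:
  assumes "0 < q" and "0 \<le> R" and c: "0 < c"
  shows "lq_ball_volume k q (c * R) = c ^ k * lq_ball_volume k q R"
proof -
  let ?P = "lborel_pow k" and ?s = "\<lambda>x. \<lambda>i\<in>{1..k}. c * x i"
  have "?s -` lq_ball k q (c * R) \<inter> space ?P = lq_ball k q R"
  proof -
    have "(\<Sum>i=1..k. \<bar>c * x i\<bar> powr q) \<le> (c * R) powr q
        \<longleftrightarrow> (\<Sum>i=1..k. \<bar>x i\<bar> powr q) \<le> R powr q" for x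
      using assms by (simp add: abs_mult powr_mult sum_distrib_left[symmetric])
    then show ?thesis
      by (auto simp: lq_ball_def space_PiM)
  qed
  moreover have "?s \<in> measurable ?P ?P"
    by measurable
  moreover have "measure ?P (lq_ball k q (c * R))
      = measure (scale_measure (ennreal (c ^ k)) (distr ?P ?P ?s)) (lq_ball k q (c * R))"
    using PiM_lborel_scale[of "{1..k}" c] c by simp
  ultimately show ?thesis
    using assms lq_ball_measurable
    by (simp add: lq_ball_volume_eq measure_distr)
qed

section \<open>Comparing the count with the volume\<close>

text \<open>
  Half-open, so that the cubes around all lattice points tile the space and not merely cover it.
\<close>

definition unit_cube :: "nat \<Rightarrow> (nat \<Rightarrow> int) \<Rightarrow> (nat \<Rightarrow> real) set" where
  "unit_cube k a = PiE {1..k} (\<lambda>i. {real_of_int (a i) - 1/2 ..< real_of_int (a i) + 1/2})"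

lemma unit_cube_sets: "unit_cube k a \<in> sets (lborel_pow k)"
  unfolding unit_cube_def by (intro sets_PiM_I_finite) auto

lemma emeasure_unit_cube: "emeasure (lborel_pow k) (unit_cube k a) = 1"
  unfolding unit_cube_def by (subst lborel_product.emeasure_PiM) auto

lemma unit_cube_round:
  assumes "x \<in> {1..k} \<rightarrow>\<^sub>E UNIV"
  shows "x \<in> unit_cube k (\<lambda>i\<in>{1..k}. round (x i))"
  using assms unfolding unit_cube_def round_def
  by (auto simp: PiE_iff) linarith+

lemma unit_cube_unique:
  assumes "a \<in> {1..k} \<rightarrow>\<^sub>E UNIV" and "x \<in> unit_cube k a"
  shows "a = (\<lambda>i\<in>{1..k}. round (x i))"
proof
  fix i
  show "a i = (\<lambda>i\<in>{1..k}. round (x i)) i"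
  proof (cases "i \<in> {1..k}")
    case True
    then have "real_of_int (a i) - 1/2 \<le> x i" "x i < real_of_int (a i) + 1/2"
      using assms(2) by (auto simp: unit_cube_def PiE_iff)
    then have "\<lfloor>x i + 1/2\<rfloor> = a i"
      by (intro floor_unique) auto
    then show ?thesis
      using True by (simp add: round_def)
  qed (use assms(1) in \<open>auto simp: PiE_iff extensional_def\<close>)
qed

lemma disjoint_unit_cubes: "disjoint_family_on (unit_cube k) ({1..k} \<rightarrow>\<^sub>E UNIV)"
  unfolding disjoint_family_on_def using unit_cube_unique by blast

lemma finite_lq_lattice_ball:
  assumes "0 < q" and "0 \<le> R"
  shows "finite (lq_lattice_ball k q R)"
proof -
  have "a i \<in> {-\<lceil>R\<rceil>..\<lceil>R\<rceil>}" if "a \<in> lq_lattice_ball k q R" "i \<in> {1..k}" for a i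
    using abs_le_if_sum_powr_le[of "{1..k}" i q R "\<lambda>i. real_of_int (a i)"] that assms
    by (simp add: lq_lattice_ball_def) linarith
  then have "lq_lattice_ball k q R \<subseteq> ({1..k} \<rightarrow>\<^sub>E {-\<lceil>R\<rceil>..\<lceil>R\<rceil>})"
    unfolding lq_lattice_ball_def by (blast intro: PiE_arb)
  then show ?thesis
    by (rule finite_subset) (intro finite_PiE, auto)
qed

lemma measure_union_unit_cubes:
  assumes "finite B" and "B \<subseteq> {1..k} \<rightarrow>\<^sub>E UNIV"
  shows "(\<Union>a\<in>B. unit_cube k a) \<in> fmeasurable (lborel_pow k)"
    and "measure (lborel_pow k) (\<Union>a\<in>B. unit_cube k a) = real (card B)"
proof -
  have "disjoint_family_on (unit_cube k) B"
    using disjoint_unit_cubes assms(2) by (rule disjoint_family_on_mono[rotated])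
  then have "emeasure (lborel_pow k) (\<Union>a\<in>B. unit_cube k a)
      = (\<Sum>a\<in>B. emeasure (lborel_pow k) (unit_cube k a))"
    using assms(1) unit_cube_sets by (intro sum_emeasure[symmetric]) auto
  then have eq: "emeasure (lborel_pow k) (\<Union>a\<in>B. unit_cube k a) = of_nat (card B)"
    by (simp only: emeasure_unit_cube sum_constant mult_1_right)
  then show "measure (lborel_pow k) (\<Union>a\<in>B. unit_cube k a) = real (card B)"
    by (simp add: measure_def)
  show "(\<Union>a\<in>B. unit_cube k a) \<in> fmeasurable (lborel_pow k)"
    using assms(1) unit_cube_sets eq by (intro fmeasurableI) (auto simp: of_nat_less_top)
qed

text \<open>The radius on the right is that of the cube's corners, the points farthest from its centre.\<close>

lemma unit_cube_radius:
  assumes "0 < q" and "x \<in> unit_cube k a"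
  shows "(\<Sum>i=1..k. \<bar>x i - real_of_int (a i)\<bar> powr q) \<le> (real k powr (1 / q) / 2) powr q"
proof -
  have "\<bar>x i - real_of_int (a i)\<bar> powr q \<le> (1/2) powr q" if "i \<in> {1..k}" for i
  proof (rule powr_mono2)
    show "\<bar>x i - real_of_int (a i)\<bar> \<le> 1/2"
      using PiE_mem[OF assms(2)[unfolded unit_cube_def] that] unfolding atLeastLessThan_iff by linarith
  qed (use assms in auto)
  then have "(\<Sum>i=1..k. \<bar>x i - real_of_int (a i)\<bar> powr q) \<le> (\<Sum>i=1..k. (1/2) powr q)"
    by (intro sum_mono) auto
  also have "\<dots> = (real k powr (1 / q) / 2) powr q"
    using assms(1) by (simp add: powr_divide powr_powr)
  finally show ?thesis .
qed

lemma card_le_volume: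
  assumes q: "1 \<le> q" and k: "1 \<le> k" and R: "0 < R"
  shows "real (card (lq_lattice_ball k q R)) \<le> lq_ball_volume k q (R + real k powr (1 / q) / 2)"
proof -
  let ?r = "real k powr (1 / q) / 2"
  let ?U = "\<Union>a\<in>lq_lattice_ball k q R. unit_cube k a"
  have "?U \<subseteq> lq_ball k q (R + ?r)"
  proof
    fix x assume "x \<in> ?U"
    then obtain a where a: "a \<in> lq_lattice_ball k q R" and x: "x \<in> unit_cube k a"
      by blast
    have "(\<Sum>i=1..k. \<bar>real_of_int (a i) + (x i - real_of_int (a i))\<bar> powr q) \<le> (R + ?r) powr q"
      using a unit_cube_radius[OF _ x, of q] q k R
      by (intro sum_abs_powr_triangle) (auto simp: lq_lattice_ball_def)
    then show "x \<in> lq_ball k q (R + ?r)"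
      using x by (auto simp: lq_ball_def unit_cube_def PiE_iff)
  qed
  then have "measure (lborel_pow k) ?U \<le> measure (lborel_pow k) (lq_ball k q (R + ?r))"
    using measure_union_unit_cubes(1)[of "lq_lattice_ball k q R" k] finite_lq_lattice_ball[of q R k]
      lq_ball_fmeasurable[of q "R + ?r" k] q R
    by (intro measure_mono_fmeasurable) (auto simp: lq_lattice_ball_def)
  then show ?thesis
    using measure_union_unit_cubes(2)[of "lq_lattice_ball k q R" k] finite_lq_lattice_ball[of q R k]
      lq_ball_volume_eq[of q "R + ?r" k] q R
    by (auto simp: lq_lattice_ball_def)
qed

text \<open>
  Here the cubes have to cover the smaller ball: each of its points lies in the cube around its
  rounding, and that rounding is moved by too little to leave the ball of radius \<open>R\<close>.
\<close>

lemma volume_le_card: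
  assumes q: "1 \<le> q" and k: "1 \<le> k" and R: "real k powr (1 / q) / 2 < R"
  shows "lq_ball_volume k q (R - real k powr (1 / q) / 2) \<le> real (card (lq_lattice_ball k q R))"
proof -
  let ?r = "real k powr (1 / q) / 2"
  let ?U = "\<Union>a\<in>lq_lattice_ball k q R. unit_cube k a"
  have R0: "0 < R"
    by (rule le_less_trans[OF _ R]) simp
  have "lq_ball k q (R - ?r) \<subseteq> ?U"
  proof
    fix x assume x: "x \<in> lq_ball k q (R - ?r)"
    define a where "a = (\<lambda>i\<in>{1..k}. round (x i))"
    have xa: "x \<in> unit_cube k a"
      unfolding a_def using x by (intro unit_cube_round) (simp add: lq_ball_def)
    have "(\<Sum>i=1..k. \<bar>x i + (real_of_int (a i) - x i)\<bar> powr q) \<le> (R - ?r + ?r) powr q"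
      using x unit_cube_radius[OF _ xa, of q] q k R
      by (intro sum_abs_powr_triangle) (auto simp: lq_ball_def abs_minus_commute)
    then have "a \<in> lq_lattice_ball k q R"
      by (simp add: lq_lattice_ball_def) (simp add: a_def)
    with xa show "x \<in> ?U"
      by blast
  qed
  then have "measure (lborel_pow k) (lq_ball k q (R - ?r)) \<le> measure (lborel_pow k) ?U"
    using measure_union_unit_cubes(1)[of "lq_lattice_ball k q R" k] finite_lq_lattice_ball[of q R k]
      lq_ball_measurable q R0
    by (intro measure_mono_fmeasurable) (auto simp: lq_lattice_ball_def)
  then show ?thesis
    using measure_union_unit_cubes(2)[of "lq_lattice_ball k q R" k] finite_lq_lattice_ball[of q R k]
      lq_ball_volume_eq[of q "R - ?r" k] q R R0
    by (auto simp: lq_lattice_ball_def)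
qed

section \<open>The asymptotic formula\<close>

lemma one_plus_power_le:
  fixes t :: real
  assumes "0 \<le> t" and "real k * t \<le> 1"
  shows "(1 + t) ^ k \<le> 1 + 2 * (real k * t)"
proof -
  have "(1 + t) ^ k \<le> exp t ^ k"
    using assms(1) by (intro power_mono exp_ge_add_one_self) auto
  also have "\<dots> = exp (real k * t)"
    by (simp add: exp_of_nat_mult)
  also have "\<dots> \<le> 1 + real k * t + (real k * t)\<^sup>2"
    using assms by (intro exp_bound) auto
  also have "(real k * t)\<^sup>2 \<le> real k * t"
    using assms power_decreasing[of 1 2 "real k * t"] by simp
  finally show ?thesis by linarith
qed

theorem lemmaE:
  fixes q :: real
  assumes "1 < q"
  shows "\<exists>C::real. \<forall>(k::nat) (R::real). 1 \<le> k \<longrightarrow> real k powr (1 + 1 / q) \<le> R \<longrightarrow>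
           (\<exists>\<epsilon>::real. \<bar>\<epsilon>\<bar> \<le> C * (real k powr (1 + 1 / q) / R) \<and>
              real (card (lq_lattice_ball k q R)) = lq_ball_volume k q R * (1 + \<epsilon>))"
proof (rule exI[of _ 1], intro allI impI)
  fix k :: nat and R :: real
  assume k: "1 \<le> k" and R: "real k powr (1 + 1 / q) \<le> R"
  define r where "r = real k powr (1 / q) / 2"
  define t where "t = r / R"
  define N where "N = real (card (lq_lattice_ball k q R))"
  define V where "V = lq_ball_volume k q R"
  define \<delta> where "\<delta> = real k powr (1 + 1 / q) / R"
  have kr: "real k powr (1 + 1 / q) = 2 * (real k * r)"
    using k by (simp add: powr_add r_def)
  have r: "0 < r"
    using k by (simp add: r_def)
  have rR: "2 * (real k * r) \<le> R"
    using R kr by simp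
  have R0: "0 < R"
    using rR r k by (smt (verit) mult_pos_pos of_nat_0_less_iff less_le_trans zero_less_one)
  have \<delta>: "\<delta> = 2 * (real k * t)" "0 \<le> \<delta>" "\<delta> \<le> 1"
    using R0 rR r by (simp_all add: \<delta>_def t_def kr)
  have t0: "0 < t"
    using r R0 by (simp add: t_def)
  have kt: "real k * t \<le> 1/2"
    using \<delta> by simp
  have t1: "t \<le> 1/2"
  proof -
    have "1 * t \<le> real k * t"
      using k t0 by (intro mult_right_mono) auto
    with kt show ?thesis by linarith
  qed
  have rt: "R - r = (1 - t) * R" "R + r = (1 + t) * R"
    using R0 by (simp_all add: t_def field_simps)
  have V0: "0 \<le> V"
    by (simp add: V_def lq_ball_volume_def)
  have "r < R"
    using t1 t0 R0 by (simp add: t_def field_simps)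
  then have "(1 - t) ^ k * V \<le> N"
    using volume_le_card[of q k R] assms k R0 t1 lq_ball_volume_scale[of q R "1 - t" k]
    by (simp add: r_def[symmetric] rt N_def V_def)
  moreover have "1 - \<delta> \<le> (1 - t) ^ k"
  proof -
    have "1 - real k * t \<le> (1 - t) ^ k"
      using Bernoulli_inequality[of "-t" k] t1 by simp
    with \<delta> show ?thesis by linarith
  qed
  ultimately have lower: "V * (1 - \<delta>) \<le> N"
    using mult_right_mono[OF _ V0] by (metis mult.commute order_trans)
  have "N \<le> (1 + t) ^ k * V"
    using card_le_volume[of q k R] assms k R0 t0 lq_ball_volume_scale[of q R "1 + t" k]
    by (simp add: r_def[symmetric] rt N_def V_def)
  moreover have "(1 + t) ^ k \<le> 1 + \<delta>"
    using one_plus_power_le[of t k] t0 kt \<delta>(1) by simp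
  ultimately have upper: "N \<le> V * (1 + \<delta>)"
    using mult_right_mono[OF _ V0] by (metis mult.commute order_trans)
  have "\<exists>\<epsilon>. \<bar>\<epsilon>\<bar> \<le> \<delta> \<and> N = V * (1 + \<epsilon>)"
  proof (cases "V = 0")
    case True
    then show ?thesis
      using lower upper \<delta>(2) by (intro exI[of _ 0]) simp
  next
    case False
    with V0 have "0 < V" by simp
    then show ?thesis
      using lower upper by (intro exI[of _ "N / V - 1"]) (auto simp: abs_le_iff field_simps)
  qed
  then show "\<exists>\<epsilon>. \<bar>\<epsilon>\<bar> \<le> 1 * (real k powr (1 + 1 / q) / R) \<and>
      real (card (lq_lattice_ball k q R)) = lq_ball_volume k q R * (1 + \<epsilon>)"
    by (simp add: \<delta>_def N_def V_def)
qed

end
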